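(* Let $h\colon[n]\to[n]$ be a Hessenberg function and $w\in\mathfrak S_n$ a generator for $h$. If $u,v\in[w,w_0]$ satisfy $u\preceq_h v$, then $|E_{w,h}(u)|\le|E_{w,h}(v)|$. Furthermore, $|E_{w,h}(w)|\le|E_{w,h}(w_0)|$.
   Context: A Hessenberg function is a nondecreasing $h\colon[n]\to[n]$ with $h(i)\ge i$. For $u\in\mathfrak S_n$ (one-line notation) and $i<j$, $u(i,j)$ is obtained from $u$ by swapping the entries in positions $i$ and $j$. $\ell(u)$ is the number of inversions of $u$. The Bruhat order $\preceq$ is the reflexive–transitive closure of $u\prec u(i,j)$ when $\ell(u)<\ell(u(i,j))$; $w_0=n(n-1)\cdots1$ and $[w,w_0]=\{u\mid w\preceq u\preceq w_0\}$. The $h$-Bruhat order $\preceq_h$ is the reflexive–transitive closure of $u\prec_h u(i,j)$ when $i<j\le h(i)$ and $\ell(u(i,j))>\ell(u)$. A generator for $h$ is a $w\in\mathfrak S_n$ with $w^{-1}(w(i)+1)\le h(i)$ for all $i$ with $w(i)\le n-1$. For $u\in[w,w_0]$, $E_{w,h}(u)=\{(i,j)\mid 1\le i<j\le h(i),\ u(i,j)\succeq w\}$; this is the set of edges at $u$ in the graph $\Gamma_{w,h}$, the subgraph induced on the vertex set $[w,w_0]$ of the graph $\Gamma_h$ with vertex set $\mathfrak S_n$ and edges $\{u,u(i,j)\}$ for $1\le i<j\le h(i)$. *)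

theory Defs
  imports "HOL-Combinatorics.Permutations"
begin

text \<open>
  The symmetric group on \<open>[n] = {1..n}\<close> is the set of functions \<open>u\<close> with \<^term>\<open>u permutes {1..n}\<close>;
  the one-line notation of \<open>u\<close> is \<open>u 1, \<dots>, u n\<close>. Outside \<open>[n]\<close> the values of a Hessenberg
  function are irrelevant.
\<close>

definition hessenberg :: "nat \<Rightarrow> (nat \<Rightarrow> nat) \<Rightarrow> bool" where
  "hessenberg n h \<longleftrightarrow>
     h \<in> {1..n} \<rightarrow> {1..n} \<and> mono_on {1..n} h \<and> (\<forall>i\<in>{1..n}. i \<le> h i)"

text \<open>\<open>swap_pos u i j\<close> is \<open>u(i,j)\<close>: composing on the right swaps positions, not values.\<close>

definition swap_pos :: "(nat \<Rightarrow> nat) \<Rightarrow> nat \<Rightarrow> nat \<Rightarrow> (nat \<Rightarrow> nat)" where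
  "swap_pos u i j = u \<circ> transpose i j"

definition inv_count :: "nat \<Rightarrow> (nat \<Rightarrow> nat) \<Rightarrow> nat" where
  "inv_count n u = card {(i, j). 1 \<le> i \<and> i < j \<and> j \<le> n \<and> u i > u j}"

definition bruhat_step :: "nat \<Rightarrow> (nat \<Rightarrow> nat) \<Rightarrow> (nat \<Rightarrow> nat) \<Rightarrow> bool" where
  "bruhat_step n u v \<longleftrightarrow> u permutes {1..n} \<and>
     (\<exists>i j. 1 \<le> i \<and> i < j \<and> j \<le> n \<and> v = swap_pos u i j \<and> inv_count n u < inv_count n v)"

definition hbruhat_step :: "nat \<Rightarrow> (nat \<Rightarrow> nat) \<Rightarrow> (nat \<Rightarrow> nat) \<Rightarrow> (nat \<Rightarrow> nat) \<Rightarrow> bool" where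
  "hbruhat_step n h u v \<longleftrightarrow> u permutes {1..n} \<and>
     (\<exists>i\<in>{1..n}. \<exists>j. i < j \<and> j \<le> h i \<and> v = swap_pos u i j \<and> inv_count n u < inv_count n v)"

text \<open>
  The condition that \<open>u\<close> is a permutation restricts the reflexive closure to the symmetric group;
  then \<open>v\<close> is a permutation as well.
\<close>

definition bruhat_le :: "nat \<Rightarrow> (nat \<Rightarrow> nat) \<Rightarrow> (nat \<Rightarrow> nat) \<Rightarrow> bool" where
  "bruhat_le n u v \<longleftrightarrow> u permutes {1..n} \<and> (bruhat_step n)\<^sup>*\<^sup>* u v"

definition hbruhat_le :: "nat \<Rightarrow> (nat \<Rightarrow> nat) \<Rightarrow> (nat \<Rightarrow> nat) \<Rightarrow> (nat \<Rightarrow> nat) \<Rightarrow> bool" where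
  "hbruhat_le n h u v \<longleftrightarrow> u permutes {1..n} \<and> (hbruhat_step n h)\<^sup>*\<^sup>* u v"

definition longest_perm :: "nat \<Rightarrow> nat \<Rightarrow> nat" where
  "longest_perm n i = (if i \<in> {1..n} then n + 1 - i else i)"

definition bruhat_interval :: "nat \<Rightarrow> (nat \<Rightarrow> nat) \<Rightarrow> (nat \<Rightarrow> nat) \<Rightarrow> (nat \<Rightarrow> nat) set" where
  "bruhat_interval n w w' = {u. bruhat_le n w u \<and> bruhat_le n u w'}"

definition generator :: "nat \<Rightarrow> (nat \<Rightarrow> nat) \<Rightarrow> (nat \<Rightarrow> nat) \<Rightarrow> bool" where
  "generator n h w \<longleftrightarrow> w permutes {1..n} \<and>
     (\<forall>i\<in>{1..n}. w i \<le> n - 1 \<longrightarrow> inv w (w i + 1) \<le> h i)"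

definition edges_at :: "nat \<Rightarrow> (nat \<Rightarrow> nat) \<Rightarrow> (nat \<Rightarrow> nat) \<Rightarrow> (nat \<Rightarrow> nat) \<Rightarrow> (nat \<times> nat) set" where
  "edges_at n h w u =
     {(i, j). i \<in> {1..n} \<and> i < j \<and> j \<le> h i \<and> bruhat_le n w (swap_pos u i j)}"

end

theory Submission
  imports Defs
begin

text \<open>
  It suffices to treat one step \<open>u \<prec>\<^sub>h v = u(a,b)\<close>. Positions outside \<open>{a,b}\<close> cause no trouble,
  and for a third position \<open>c\<close> only the six permutations obtained by rearranging the entries at
  \<open>a\<close>, \<open>b\<close>, \<open>c\<close> matter. Those above \<open>w\<close> form an upper set in this copy of the Bruhat order of
  \<open>S\<^sub>3\<close>. The only upper set that could destroy the inequality is the one missing just the minimum,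
  and the rank matrix criterion excludes it: the rank matrices of the two atoms exceed that of the
  minimum in disjoint regions. Hence an edge at \<open>u\<close> that is lost at \<open>v\<close> is compensated by its image
  under \<open>(a b)\<close>, which is an edge at \<open>v\<close> but not at \<open>u\<close>.

  The generator condition gives \<open>w \<preceq>\<^sub>h w\<^sub>0\<close>: where \<open>h i = i\<close>, it forces \<open>w\<close>, and then every \<open>u \<succeq> w\<close>,
  to send \<open>{1..i}\<close> to the \<open>i\<close> largest values, so only \<open>w\<^sub>0\<close> admits no upward \<open>h\<close>-step.
\<close>

section \<open>Inversions\<close>

lemma swap_pos_apply:
  "swap_pos u i j k = (if k = i then u j else if k = j then u i else u k)"
  by (simp add: swap_pos_def transpose_def)

lemma swap_pos_commute: "swap_pos u i j = swap_pos u j i"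
  by (simp add: swap_pos_def transpose_commute)

lemma swap_pos_involutory [simp]: "swap_pos (swap_pos u i j) i j = u"
  by (simp add: fun_eq_iff swap_pos_apply)

lemma permutes_swap_pos:
  assumes "u permutes {1..n}" "i \<in> {1..n}" "j \<in> {1..n}"
  shows "swap_pos u i j permutes {1..n}"
  unfolding swap_pos_def using assms by (intro permutes_compose permutes_swap_id)

lemma finite_inversions:
  fixes n :: nat and u :: "nat \<Rightarrow> nat"
  shows "finite {(i, j). 1 \<le> i \<and> i < j \<and> j \<le> n \<and> u j < u i}"
  by (rule finite_subset[of _ "{..n} \<times> {..n}"]) auto

lemma inv_count_le: "inv_count n u \<le> n * n"
proof -
  have "inv_count n u \<le> card ({1..n} \<times> {1..n})"
    unfolding inv_count_def by (rule card_mono) auto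
  then show ?thesis by simp
qed

text \<open>The map \<open>f\<close> carries an inversion along the transposition when the order of
  the two positions survives and leaves it in place otherwise. It injects the inversions of
  \<open>u\<close> into those of the swapped permutation and misses the new inversion
  \<open>(i, j)\<close>.\<close>

lemma inv_count_swap_pos_less:
  assumes ij: "1 \<le> i" "i < j" "j \<le> n" and less: "u i < u j"
  shows "inv_count n u < inv_count n (swap_pos u i j)"
proof -
  let ?t = "transpose i j"
  let ?I = "\<lambda>u. {(k, l). 1 \<le> k \<and> k < l \<and> l \<le> n \<and> u l < u k}"
  define f where
    "f = (\<lambda>(k, l). if ?t k < ?t l then (?t k, ?t l) else (k, l))"
  have inj: "inj_on f (?I u)"
  proof (rule inj_on_inverseI)
    fix p assume "p \<in> ?I u"
    then obtain k l where "p = (k, l)" "k < l" by blast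
    then show "f (f p) = p" by (cases "?t k < ?t l") (simp_all add: f_def)
  qed
  have "f p \<in> ?I (swap_pos u i j) - {(i, j)}" if "p \<in> ?I u" for p
  proof -
    from that obtain k l where "p = (k, l)" "1 \<le> k" "k < l" "l \<le> n" "u l < u k"
      by blast
    then show ?thesis
      using ij less unfolding f_def
      by (cases "k = i"; cases "k = j"; cases "l = i"; cases "l = j")
        (simp_all add: swap_pos_apply transpose_def)
  qed
  then have "f ` ?I u \<subseteq> ?I (swap_pos u i j) - {(i, j)}" by (rule image_subsetI)
  then have "card (?I u) \<le> card (?I (swap_pos u i j) - {(i, j)})"
    using finite_inversions[of n "swap_pos u i j"]
    by (intro card_inj_on_le[OF inj]) simp_all
  also have "\<dots> < card (?I (swap_pos u i j))"
    using finite_inversions[of n "swap_pos u i j"] ij less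
    by (intro card_Diff1_less) (auto simp: swap_pos_apply)
  finally show ?thesis by (simp add: inv_count_def)
qed

lemma inv_count_swap_pos_less_iff:
  assumes u: "u permutes {1..n}" and ij: "1 \<le> i" "i < j" "j \<le> n"
  shows "inv_count n u < inv_count n (swap_pos u i j) \<longleftrightarrow> u i < u j"
proof
  assume *: "inv_count n u < inv_count n (swap_pos u i j)"
  show "u i < u j"
  proof (rule ccontr)
    assume "\<not> u i < u j"
    moreover have "u i \<noteq> u j"
      using permutes_inj[OF u] ij by (auto dest: injD)
    ultimately have "swap_pos u i j i < swap_pos u i j j"
      using ij by (simp add: swap_pos_apply)
    from inv_count_swap_pos_less[where u = "swap_pos u i j", OF ij this] * show False by simp
  qed
qed (rule inv_count_swap_pos_less[where u = u, OF ij])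

section \<open>The rank matrix criterion\<close>

text \<open>Large values in prefixes are counted, so that going up in the Bruhat order increases
  every entry of the matrix.\<close>

definition rank_mat :: "(nat \<Rightarrow> nat) \<Rightarrow> nat \<Rightarrow> nat \<Rightarrow> nat" where
  "rank_mat u m k = card {l \<in> {1..m}. k \<le> u l}"

lemma rank_mat_eq_sum: "rank_mat u m k = (\<Sum>l\<in>{1..m}. of_bool (k \<le> u l))"
  by (simp add: rank_mat_def of_bool_def sum.If_cases Int_def)

text \<open>Only prefixes containing \<open>i\<close> but not \<open>j\<close> notice the swap.
  There the entry \<open>u i\<close> is replaced by \<open>u j\<close>, which gains one exactly for
  thresholds in the interval \<open>(u i, u j]\<close>.\<close>

lemma rank_mat_swap_pos:
  assumes i: "1 \<le> i" "i < j" and less: "u i < u j"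
  shows "rank_mat (swap_pos u i j) m k =
    rank_mat u m k + of_bool (i \<le> m \<and> m < j \<and> u i < k \<and> k \<le> u j)"
proof -
  consider "m < i" | "i \<le> m" "m < j" | "j \<le> m" by linarith
  then show ?thesis
  proof cases
    case 1
    then have "rank_mat (swap_pos u i j) m k = rank_mat u m k"
      using i unfolding rank_mat_eq_sum by (intro sum.cong) (auto simp: swap_pos_apply)
    with 1 show ?thesis by simp
  next
    case 2
    then have im: "i \<in> {1..m}" using i by simp
    have "(\<Sum>l\<in>{1..m} - {i}. of_bool (k \<le> swap_pos u i j l)) =
      (\<Sum>l\<in>{1..m} - {i}. of_bool (k \<le> u l) :: nat)"
      using 2 by (intro sum.cong) (auto simp: swap_pos_apply)
    with 2 less show ?thesis
      unfolding rank_mat_eq_sum sum.remove[OF finite_atLeastAtMost im]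
      by (auto simp: swap_pos_apply)
  next
    case 3
    have "transpose i j permutes {1..m}"
      using 3 i by (intro permutes_swap_id) auto
    from sum.permute[OF this, of "\<lambda>l. of_bool (k \<le> u l) :: nat"]
    have "rank_mat (swap_pos u i j) m k = rank_mat u m k"
      by (simp add: rank_mat_eq_sum swap_pos_def o_def)
    with 3 show ?thesis by simp
  qed
qed

section \<open>Bruhat order versus entrywise order of rank matrices\<close>

lemma bruhat_le_refl: "u permutes {1..n} \<Longrightarrow> bruhat_le n u u"
  by (simp add: bruhat_le_def)

lemma bruhat_step_permutes: "bruhat_step n u v \<Longrightarrow> v permutes {1..n}"
  by (auto simp: bruhat_step_def simp del: One_nat_def intro!: permutes_swap_pos)

lemma bruhat_le_permutes:
  assumes "bruhat_le n w u"
  shows "u permutes {1..n}"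
proof -
  from assms have "(bruhat_step n)\<^sup>*\<^sup>* w u" "w permutes {1..n}"
    by (simp_all add: bruhat_le_def)
  then show ?thesis by induction (auto dest: bruhat_step_permutes)
qed

lemma bruhat_le_swap_pos:
  assumes wu: "bruhat_le n w u" and ij: "1 \<le> i" "i < j" "j \<le> n" and less: "u i < u j"
  shows "bruhat_le n w (swap_pos u i j)"
proof -
  have "bruhat_step n u (swap_pos u i j)"
    unfolding bruhat_step_def
    using bruhat_le_permutes[OF wu] ij inv_count_swap_pos_less[where u = u, OF ij less] by blast
  with wu show ?thesis by (auto simp: bruhat_le_def)
qed

lemma bruhat_le_imp_rank_mat_le:
  assumes "bruhat_le n w u"
  shows "rank_mat w m k \<le> rank_mat u m k"
proof -
  from assms have "(bruhat_step n)\<^sup>*\<^sup>* w u" by (simp add: bruhat_le_def)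
  then show ?thesis
  proof induction
    case (step u v)
    then obtain i j where ij: "1 \<le> i" "i < j" "j \<le> n" and v: "v = swap_pos u i j"
      and "u permutes {1..n}" "inv_count n u < inv_count n v"
      by (auto simp: bruhat_step_def)
    then have "u i < u j" using inv_count_swap_pos_less_iff by blast
    then have "rank_mat u m k \<le> rank_mat v m k"
      using ij by (simp add: v rank_mat_swap_pos)
    with step.IH show ?case by simp
  qed simp
qed

text \<open>
  At the first position \<open>a\<close> where \<open>w\<close> and \<open>z\<close> differ, \<open>w a < z a\<close>. Swapping \<open>a\<close> with the next
  position \<open>j\<close> whose entry lies in \<open>(w a, z a]\<close> keeps the rank matrix below that of \<open>z\<close>.
\<close>

lemma rank_mat_le_step:
  assumes w: "w permutes {1..n}" and z: "z permutes {1..n}" and "w \<noteq> z"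
    and le: "\<And>m k. rank_mat w m k \<le> rank_mat z m k"
  obtains i j where "1 \<le> i" "i < j" "j \<le> n" "w i < w j"
    "\<And>m k. rank_mat (swap_pos w i j) m k \<le> rank_mat z m k"
proof -
  have "\<exists>l. w l \<noteq> z l" using \<open>w \<noteq> z\<close> by auto
  then obtain a where a: "w a \<noteq> z a" and eq: "\<And>l. l < a \<Longrightarrow> w l = z l"
    using exists_least_iff[of "\<lambda>l. w l \<noteq> z l"] by auto
  have a_in: "a \<in> {1..n}" using a w z by (metis permutes_not_in)
  have split: "{1..a} = insert a {1..<a}" using a_in by auto
  have less: "w a < z a"
  \<comment> \<open>Otherwise, with threshold \<open>w a\<close>, the prefix up to \<open>a\<close>
    would count position \<open>a\<close> for \<open>w\<close> but not for \<open>z\<close>, while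
    all earlier positions agree.\<close>
  proof (rule ccontr)
    assume "\<not> w a < z a"
    moreover have "(\<Sum>l\<in>{1..<a}. of_bool (w a \<le> w l)) = (\<Sum>l\<in>{1..<a}. of_bool (w a \<le> z l) :: nat)"
      by (intro sum.cong) (auto simp: eq)
    ultimately show False
      using le[of a "w a"] a unfolding rank_mat_eq_sum split by auto
  qed
  let ?P = "\<lambda>j. a < j \<and> w a < w j \<and> w j \<le> z a"
  \<comment> \<open>The position of the value \<open>z a\<close> in \<open>w\<close> is a candidate
    for \<open>j\<close>. It is not before \<open>a\<close>, since \<open>w\<close> and
    \<open>z\<close> agree there and \<open>z\<close> is injective.\<close>
  obtain j0 where j0: "w j0 = z a" using permutes_surj[OF w] by (metis surjD)
  have "\<not> j0 < a" using eq[of j0] j0 permutes_inj[OF z] by (auto dest: injD)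
  moreover have "j0 \<noteq> a" using j0 a by auto
  ultimately have "?P j0" using j0 less by auto
  then obtain j where j: "?P j" and j_min: "\<And>l. l < j \<Longrightarrow> \<not> ?P l"
    using exists_least_iff[of ?P] by blast
  have "z a \<in> {1..n}" using a_in z by (simp add: permutes_in_image del: atLeastAtMost_iff)
  then have "w j \<in> {1..n}" using j by auto
  then have j_in: "j \<in> {1..n}" using w by (simp add: permutes_in_image del: atLeastAtMost_iff)
  have "rank_mat (swap_pos w a j) m k \<le> rank_mat z m k" for m k
  proof (cases "a \<le> m \<and> m < j \<and> w a < k \<and> k \<le> w j")
    case True
    let ?A = "{l \<in> {1..m}. z a < w l}" and ?B = "{l \<in> {1..<a}. k \<le> z l \<and> z l \<le> z a}"
    have "k \<le> z a" using True j by simp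
    \<comment> \<open>An entry of \<open>w\<close> in the prefix with value in
      \<open>[k, z a]\<close> lies before \<open>a\<close>, because \<open>j\<close> is minimal and
      \<open>m < j\<close>. At such positions \<open>w\<close> and \<open>z\<close> agree.\<close>
    have "{l \<in> {1..m}. k \<le> w l} \<subseteq> ?A \<union> ?B"
    proof
      fix l assume l: "l \<in> {l \<in> {1..m}. k \<le> w l}"
      show "l \<in> ?A \<union> ?B"
      proof (cases "z a < w l")
        case False
        then have "l < j" "w a < w l" "w l \<le> z a" using l True by auto
        then have "l < a" using j_min[of l] by (cases "l = a") auto
        then show ?thesis using l False eq by auto
      qed (use l in auto)
    qed
    then have "rank_mat w m k \<le> card (?A \<union> ?B)"
      unfolding rank_mat_def by (rule card_mono[rotated]) auto
    also have "\<dots> \<le> card ?A + card ?B" by (rule card_Un_le)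
    also have "card ?A \<le> card {l \<in> {1..m}. z a < z l}"
      using le[of m "Suc (z a)"] by (simp add: rank_mat_def Suc_le_eq)
    also have "card {l \<in> {1..m}. z a < z l} + card ?B = card ({l \<in> {1..m}. z a < z l} \<union> ?B)"
      by (rule card_Un_disjoint[symmetric]) auto
    \<comment> \<open>Position \<open>a\<close> itself is counted only on the right; this pays for
      the one added by the swap.\<close>
    also have "\<dots> < card {l \<in> {1..m}. k \<le> z l}"
      by (rule psubset_card_mono) (use True a_in \<open>k \<le> z a\<close> in auto)
    finally show ?thesis
      using rank_mat_swap_pos[of a j w m k] a_in j by (simp add: rank_mat_def True)
  next
    case False
    have "rank_mat (swap_pos w a j) m k = rank_mat w m k"
      using False rank_mat_swap_pos[of a j w m k] a_in j by (simp del: of_bool_eq_0_iff)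
    then show ?thesis using le by simp
  qed
  then show thesis using that[of a j] a_in j j_in by auto
qed

text \<open>Climb from \<open>w\<close> by swaps that keep the rank matrix below that of
  \<open>z\<close>. The inversion number is at most \<open>n * n\<close>, so the climb ends, and it
  can end only at \<open>z\<close>.\<close>

lemma rank_mat_le_imp_bruhat_le:
  assumes "w permutes {1..n}" "z permutes {1..n}"
    and "\<And>m k. rank_mat w m k \<le> rank_mat z m k"
  shows "bruhat_le n w z"
  using assms
proof (induction "n * n - inv_count n w" arbitrary: w rule: less_induct)
  case less
  show ?case
  proof (cases "w = z")
    case True
    with less.prems show ?thesis by (simp add: bruhat_le_refl)
  next
    case False
    then obtain i j where ij: "1 \<le> i" "i < j" "j \<le> n" and wij: "w i < w j"
      and le: "\<And>m k. rank_mat (swap_pos w i j) m k \<le> rank_mat z m k"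
      using rank_mat_le_step[OF less.prems(1,2) _ less.prems(3)] by blast
    have perm: "swap_pos w i j permutes {1..n}"
      using ij less.prems(1) by (intro permutes_swap_pos) auto
    have inv: "inv_count n w < inv_count n (swap_pos w i j)"
      using ij wij by (rule inv_count_swap_pos_less)
    then have "n * n - inv_count n (swap_pos w i j) < n * n - inv_count n w"
      using inv_count_le[of n "swap_pos w i j"] by linarith
    then have "bruhat_le n (swap_pos w i j) z"
      using less.hyps[OF _ perm less.prems(2) le] by blast
    moreover have "bruhat_step n w (swap_pos w i j)"
      using ij inv less.prems(1) by (auto simp: bruhat_step_def)
    ultimately show ?thesis
      using less.prems(1) by (auto simp: bruhat_le_def intro: converse_rtranclp_into_rtranclp)
  qed
qed

lemma bruhat_le_meet:
  assumes "1 \<le> i" "i < j" "j < k" "k \<le> n" and less: "u i < u j" "u j < u k"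
    and ij: "bruhat_le n w (swap_pos u i j)" and jk: "bruhat_le n w (swap_pos u j k)"
  shows "bruhat_le n w u"
proof (rule rank_mat_le_imp_bruhat_le)
  show "w permutes {1..n}" using ij by (simp add: bruhat_le_def)
  show "u permutes {1..n}"
    using permutes_swap_pos[OF bruhat_le_permutes[OF ij], of i j] assms by simp
  fix m l
  show "rank_mat w m l \<le> rank_mat u m l"
    \<comment> \<open>Swapping \<open>j\<close> and \<open>k\<close> leaves prefixes with
      \<open>m < j\<close> unchanged, and swapping \<open>i\<close> and \<open>j\<close> leaves
      those with \<open>j \<le> m\<close> unchanged. So at each entry one of the two bounds is
      already a bound for \<open>u\<close>.\<close>
    using bruhat_le_imp_rank_mat_le[OF ij, of m l] bruhat_le_imp_rank_mat_le[OF jk, of m l] assms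
    by (cases "m < j") (auto simp: rank_mat_swap_pos)
qed

section \<open>Edges along a cover\<close>

text \<open>Abstracts the Bruhat order to a predicate on three values: closure under the three
  upward swaps, and the meet property of the two atoms. These rules reduce the exchange of edges to
  a case analysis on the order of the values.\<close>

lemma bruhat_le_triple:
  fixes u w :: "nat \<Rightarrow> nat"
  assumes pos: "1 \<le> i" "i < j" "j < k" "k \<le> n"
    and Q_def: "Q = (\<lambda>x y z. bruhat_le n w (u(i := x, j := y, k := z)))"
  shows "Q x y z \<Longrightarrow> x < y \<Longrightarrow> Q y x z"
    and "Q x y z \<Longrightarrow> x < z \<Longrightarrow> Q z y x"
    and "Q x y z \<Longrightarrow> y < z \<Longrightarrow> Q x z y"
    and "x < y \<Longrightarrow> y < z \<Longrightarrow> Q y x z \<Longrightarrow> Q x z y \<Longrightarrow> Q x y z"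
proof -
  let ?g = "\<lambda>x y z. u(i := x, j := y, k := z)"
  have swap: "swap_pos (?g x y z) i j = ?g y x z" "swap_pos (?g x y z) i k = ?g z y x"
    "swap_pos (?g x y z) j k = ?g x z y" for x y z
    using pos by (auto simp: fun_eq_iff swap_pos_apply)
  show "Q x y z \<Longrightarrow> x < y \<Longrightarrow> Q y x z"
    using bruhat_le_swap_pos[of n w "?g x y z" i j] pos by (simp add: Q_def swap)
  show "Q x y z \<Longrightarrow> x < z \<Longrightarrow> Q z y x"
    using bruhat_le_swap_pos[of n w "?g x y z" i k] pos by (simp add: Q_def swap)
  show "Q x y z \<Longrightarrow> y < z \<Longrightarrow> Q x z y"
    using bruhat_le_swap_pos[of n w "?g x y z" j k] pos by (simp add: Q_def swap)
  show "x < y \<Longrightarrow> y < z \<Longrightarrow> Q y x z \<Longrightarrow> Q x z y \<Longrightarrow> Q x y z"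
    using bruhat_le_meet[of i j k n "?g x y z" w] pos by (simp add: Q_def swap)
qed

text \<open>The conclusions \<open>a < c\<close> and \<open>c < b\<close> rule out losing an edge
  \<open>(c, a)\<close> with \<open>c < a\<close> or \<open>(b, c)\<close> with
  \<open>b < c\<close>. The images of those under the transposition are longer and could violate the
  bound by \<open>h\<close>.\<close>

lemma edge_exchange:
  fixes u w :: "nat \<Rightarrow> nat"
  assumes wu: "bruhat_le n w u" and ab: "1 \<le> a" "a < b" "b \<le> n" and less: "u a < u b"
    and c: "c \<in> {1..n}" "c \<noteq> a" "c \<noteq> b"
  defines "v \<equiv> swap_pos u a b"
  defines "eu \<equiv> \<lambda>x. bruhat_le n w (swap_pos u x c)"
    and "ev \<equiv> \<lambda>x. bruhat_le n w (swap_pos v x c)"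
  shows "eu a \<Longrightarrow> \<not> ev a \<Longrightarrow> ev b \<and> \<not> eu b \<and> a < c"
    and "eu b \<Longrightarrow> \<not> ev b \<Longrightarrow> ev a \<and> \<not> eu a \<and> c < b"
proof -
  have inj: "u c \<noteq> u a" "u c \<noteq> u b"
    using c by (simp_all add: inj_eq[OF permutes_inj[OF bruhat_le_permutes[OF wu]]])
  consider "b < c" | "a < c" "c < b" | "c < a" using c by linarith
  then have "(eu a \<longrightarrow> \<not> ev a \<longrightarrow> ev b \<and> \<not> eu b \<and> a < c) \<and>
    (eu b \<longrightarrow> \<not> ev b \<longrightarrow> ev a \<and> \<not> eu a \<and> c < b)"
  proof cases
    case 1
    define Q where "Q = (\<lambda>x y z. bruhat_le n w (u(a := x, b := y, c := z)))"
    have pos: "1 \<le> a" "a < b" "b < c" "c \<le> n"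
      using 1 ab c by auto
    note Q = bruhat_le_triple[OF pos Q_def]
    have "swap_pos u a c = u(a := u c, b := u b, c := u a)"
      "swap_pos u b c = u(a := u a, b := u c, c := u b)"
      "swap_pos v a c = u(a := u c, b := u a, c := u b)"
      "swap_pos v b c = u(a := u b, b := u c, c := u a)"
      using pos by (auto simp: fun_eq_iff swap_pos_apply v_def)
    then have "eu a = Q (u c) (u b) (u a)" "eu b = Q (u a) (u c) (u b)"
      "ev a = Q (u c) (u a) (u b)" "ev b = Q (u b) (u c) (u a)"
      by (simp_all add: eu_def ev_def Q_def)
    moreover have "Q (u a) (u b) (u c)"
      using wu by (simp add: Q_def)
    moreover have "Q (u a) (u c) (u b) \<Longrightarrow> Q (u b) (u c) (u a)"
      by (rule Q(2)[OF _ less])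
    moreover have "Q (u c) (u b) (u a) \<Longrightarrow> Q (u b) (u c) (u a)"
      using Q(1)[of "u c" "u b" "u a"] Q(3)[of "u a" "u b" "u c"] Q(2)[of "u a" "u c" "u b"]
        \<open>Q (u a) (u b) (u c)\<close> less inj by (metis linorder_neqE_nat)
    \<comment> \<open>If \<open>u c < u a\<close>, the premises are the two atoms above the minimum
      \<open>Q (u c) (u a) (u b)\<close>, and the meet property applies. Otherwise the first premise
      suffices, by one upward swap.\<close>
    moreover have "Q (u a) (u c) (u b) \<Longrightarrow> Q (u c) (u b) (u a) \<Longrightarrow> Q (u c) (u a) (u b)"
      using Q(1)[of "u a" "u c" "u b"] Q(4)[of "u c" "u a" "u b"] less inj
      by (metis linorder_neqE_nat)
    ultimately show ?thesis using pos by (metis less_trans)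
  next
    case 2
    define Q where "Q = (\<lambda>x y z. bruhat_le n w (u(a := x, c := y, b := z)))"
    have pos: "1 \<le> a" "a < c" "c < b" "b \<le> n"
      using 2 ab c by auto
    note Q = bruhat_le_triple[OF pos Q_def]
    have "swap_pos u a c = u(a := u c, c := u a, b := u b)"
      "swap_pos u b c = u(a := u a, c := u b, b := u c)"
      "swap_pos v a c = u(a := u c, c := u b, b := u a)"
      "swap_pos v b c = u(a := u b, c := u a, b := u c)"
      using pos by (auto simp: fun_eq_iff swap_pos_apply v_def)
    then have "eu a = Q (u c) (u a) (u b)" "eu b = Q (u a) (u b) (u c)"
      "ev a = Q (u c) (u b) (u a)" "ev b = Q (u b) (u a) (u c)"
      by (simp_all add: eu_def ev_def Q_def)
    moreover have "Q (u a) (u c) (u b)"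
      using wu by (simp add: Q_def)
    \<comment> \<open>With \<open>c\<close> between \<open>a\<close> and \<open>b\<close>, one
      upward swap turns each edge at \<open>u\<close> into the corresponding edge at
      \<open>v\<close>, so none is lost.\<close>
    ultimately show ?thesis
      using Q(3)[of "u c" "u a" "u b"] Q(1)[of "u a" "u b" "u c"] less by metis
  next
    case 3
    define Q where "Q = (\<lambda>x y z. bruhat_le n w (u(c := x, a := y, b := z)))"
    have pos: "1 \<le> c" "c < a" "a < b" "b \<le> n"
      using 3 ab c by auto
    note Q = bruhat_le_triple[OF pos Q_def]
    have "swap_pos u a c = u(c := u a, a := u c, b := u b)"
      "swap_pos u b c = u(c := u b, a := u a, b := u c)"
      "swap_pos v a c = u(c := u b, a := u c, b := u a)"
      "swap_pos v b c = u(c := u a, a := u b, b := u c)"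
      using pos by (auto simp: fun_eq_iff swap_pos_apply v_def)
    then have "eu a = Q (u a) (u c) (u b)" "eu b = Q (u b) (u a) (u c)"
      "ev a = Q (u b) (u c) (u a)" "ev b = Q (u a) (u b) (u c)"
      by (simp_all add: eu_def ev_def Q_def)
    moreover have "Q (u c) (u a) (u b)"
      using wu by (simp add: Q_def)
    moreover have "Q (u a) (u c) (u b) \<Longrightarrow> Q (u b) (u c) (u a)"
      by (rule Q(2)[OF _ less])
    moreover have "Q (u b) (u a) (u c) \<Longrightarrow> Q (u b) (u c) (u a)"
      using Q(3)[of "u b" "u a" "u c"] Q(1)[of "u c" "u a" "u b"] Q(2)[of "u a" "u c" "u b"]
        \<open>Q (u c) (u a) (u b)\<close> less inj by (metis linorder_neqE_nat)
    \<comment> \<open>The mirror image of the case \<open>b < c\<close>: here the meet property is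
      used when \<open>u b < u c\<close>.\<close>
    moreover have "Q (u a) (u c) (u b) \<Longrightarrow> Q (u b) (u a) (u c) \<Longrightarrow> Q (u a) (u b) (u c)"
      using Q(3)[of "u a" "u c" "u b"] Q(4)[of "u a" "u b" "u c"] less inj
      by (metis linorder_neqE_nat)
    ultimately show ?thesis using pos by (metis less_trans)
  qed
  then show "eu a \<Longrightarrow> \<not> ev a \<Longrightarrow> ev b \<and> \<not> eu b \<and> a < c"
    and "eu b \<Longrightarrow> \<not> ev b \<Longrightarrow> ev a \<and> \<not> eu a \<and> c < b" by blast+
qed

section \<open>Injecting the edges at one end of an h-step into those at the other\<close>

lemma mem_edges_at_min_max:
  "x \<noteq> y \<Longrightarrow> (min x y, max x y) \<in> edges_at n h w u \<longleftrightarrow>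
    min x y \<in> {1..n} \<and> max x y \<le> h (min x y) \<and> bruhat_le n w (swap_pos u x y)"
  by (cases "x < y") (auto simp: edges_at_def min_def max_def swap_pos_commute)

lemma hessenberg_bounds:
  assumes "hessenberg n h" "i \<in> {1..n}"
  shows "i \<le> h i" "h i \<le> n"
  using assms by (auto simp: hessenberg_def Pi_iff)

lemma hessenberg_mono:
  assumes "hessenberg n h" "i \<in> {1..n}" "j \<in> {1..n}" "i \<le> j"
  shows "h i \<le> h j"
  using assms by (auto simp: hessenberg_def mono_on_def)

lemma finite_edges_at: "hessenberg n h \<Longrightarrow> finite (edges_at n h w u)"
  by (rule finite_subset[of _ "{1..n} \<times> {1..n}"])
    (auto simp: edges_at_def dest: hessenberg_bounds(2)[of n h])

lemma lost_edge_compensated: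
  assumes h: "hessenberg n h" and wu: "bruhat_le n w u"
    and ab: "a \<in> {1..n}" "a < b" "b \<le> h a" and less: "u a < u b"
    and ij: "(i, j) \<in> edges_at n h w u - edges_at n h w (swap_pos u a b)"
  defines "i' \<equiv> transpose a b i" and "j' \<equiv> transpose a b j"
  shows "(min i' j', max i' j') \<in> edges_at n h w (swap_pos u a b) - edges_at n h w u"
proof -
  let ?v = "swap_pos u a b"
  have bn: "b \<le> n" "1 \<le> a" "b \<in> {1..n}" using hessenberg_bounds(2)[OF h ab(1)] ab by auto
  from ij have i: "i \<in> {1..n}" "i < j" "j \<le> h i" and uij: "bruhat_le n w (swap_pos u i j)"
    and vij: "\<not> bruhat_le n w (swap_pos ?v i j)"
    by (auto simp: edges_at_def)
  have j: "j \<in> {1..n}" using hessenberg_bounds(2)[OF h i(1)] i by auto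
  note exch = edge_exchange[OF wu bn(2) ab(2) bn(1) less]
  have "i \<in> {a, b} \<or> j \<in> {a, b}"
  proof (rule ccontr)
    assume *: "\<not> (i \<in> {a, b} \<or> j \<in> {a, b})"
    \<comment> \<open>Disjoint transpositions commute, and \<open>swap_pos u i j\<close> still has
      an ascent from \<open>a\<close> to \<open>b\<close>, so such an edge survives.\<close>
    have "swap_pos ?v i j = swap_pos (swap_pos u i j) a b"
      using * by (auto simp: fun_eq_iff swap_pos_apply)
    moreover have "bruhat_le n w (swap_pos (swap_pos u i j) a b)"
      using * less by (intro bruhat_le_swap_pos uij bn ab) (simp add: swap_pos_apply)
    ultimately show False using vij by simp
  qed
  \<comment> \<open>Swapping \<open>a\<close> and \<open>b\<close> back gives \<open>u\<close>,
    which is above \<open>w\<close>.\<close>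
  moreover have "\<not> (i = a \<and> j = b)" using vij wu by auto
  moreover have "j \<noteq> a"
  proof
    assume "j = a"
    then show False using exch(1)[of i] uij vij i ab by (simp add: swap_pos_commute[of _ a i])
  qed
  moreover have "i \<noteq> b"
    using exch(2)[of j] uij vij i j ab by auto
  ultimately consider "i = a" "j \<noteq> b" | "j = b" "i \<noteq> a" by blast
  then show ?thesis
  proof cases
    case 1
    then have eq: "i' = b" "j' = j" using i by (simp_all add: i'_def j'_def transpose_def)
    have "bruhat_le n w (swap_pos ?v b j)" "\<not> bruhat_le n w (swap_pos u b j)"
      using exch(1)[of j] uij vij 1 i j by auto
    \<comment> \<open>Both \<open>b\<close> and \<open>j\<close> lie strictly right of
      \<open>a\<close> and are at most \<open>h a\<close>; monotonicity moves the bound to the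
      smaller of them.\<close>
    moreover have "max b j \<le> h (min b j)"
      using hessenberg_mono[OF h ab(1) j] hessenberg_mono[OF h ab(1) bn(3)] i ab 1
      by (auto simp: max_def min_def)
    ultimately show ?thesis using 1 bn j by (simp add: eq mem_edges_at_min_max)
  next
    case 2
    then have eq: "i' = i" "j' = a" using i by (simp_all add: i'_def j'_def transpose_def)
    have "bruhat_le n w (swap_pos ?v i a)" "\<not> bruhat_le n w (swap_pos u i a)"
      using exch(2)[of i] uij vij 2 i by (auto simp: swap_pos_commute[of _ _ i])
    moreover have "max i a \<le> h (min i a)"
      using i ab 2 by (auto simp: max_def min_def)
    moreover have "min i a \<in> {1..n}" using ab(1) i(1) by (simp add: min_def)
    ultimately show ?thesis using 2 by (simp add: eq mem_edges_at_min_max)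
  qed
qed

lemma card_edges_at_swap_pos_le:
  assumes h: "hessenberg n h" and wu: "bruhat_le n w u"
    and ab: "a \<in> {1..n}" "a < b" "b \<le> h a" and less: "u a < u b"
  shows "card (edges_at n h w u) \<le> card (edges_at n h w (swap_pos u a b))"
proof -
  let ?E = "edges_at n h w u" and ?F = "edges_at n h w (swap_pos u a b)"
  define \<tau> where "\<tau> = (\<lambda>(i, j). (min (transpose a b i) (transpose a b j),
    max (transpose a b i) (transpose a b j)))"
  have \<tau>: "\<tau> p \<in> ?F - ?E" if "p \<in> ?E - ?F" for p
    using lost_edge_compensated[OF assms, of "fst p" "snd p"] that
    by (simp add: \<tau>_def case_prod_beta)
  have \<tau>\<tau>: "\<tau> (\<tau> p) = p" if "p \<in> ?E" for p
  proof -
    obtain i j where p: "p = (i, j)" by (cases p)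
    then have "i < j" using that by (simp add: edges_at_def)
    then show ?thesis
      by (cases "transpose a b i < transpose a b j") (simp_all add: p \<tau>_def min_def max_def)
  qed
  \<comment> \<open>Common edges stay fixed and lost ones move by the involution
    \<open>\<tau>\<close>. The two kinds of image cannot collide, since the first lie in
    \<open>?E\<close> and the second outside it.\<close>
  define f where "f = (\<lambda>p. if p \<in> ?F then p else \<tau> p)"
  have "inj_on f ?E"
  proof (rule inj_onI)
    fix p q assume p: "p \<in> ?E" and q: "q \<in> ?E" and eq: "f p = f q"
    show "p = q"
      using \<tau>[of p] \<tau>[of q] \<tau>\<tau>[OF p] \<tau>\<tau>[OF q] p q eq[unfolded f_def] by (metis Diff_iff)
  qed
  moreover have "f ` ?E \<subseteq> ?F"
    using \<tau> by (intro image_subsetI) (simp add: f_def)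
  ultimately show ?thesis using finite_edges_at[OF h] by (rule card_inj_on_le)
qed

lemma hbruhat_le_edges_at:
  assumes h: "hessenberg n h" and wu: "bruhat_le n w u" and uv: "hbruhat_le n h u v"
  shows "bruhat_le n w v \<and> card (edges_at n h w u) \<le> card (edges_at n h w v)"
proof -
  from uv have "(hbruhat_step n h)\<^sup>*\<^sup>* u v" by (simp add: hbruhat_le_def)
  then show ?thesis
  proof induction
    case base
    show ?case using wu by simp
  next
    case (step x y)
    then obtain i j where ij: "i \<in> {1..n}" "i < j" "j \<le> h i" and y: "y = swap_pos x i j"
      and x: "x permutes {1..n}" and inv: "inv_count n x < inv_count n y"
      by (auto simp: hbruhat_step_def)
    have bounds: "1 \<le> i" "j \<le> n" using ij hessenberg_bounds(2)[OF h ij(1)] by auto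
    then have less: "x i < x j" using inv inv_count_swap_pos_less_iff[OF x] ij by (simp add: y)
    from step.IH have wx: "bruhat_le n w x" by simp
    show ?case
      using step.IH bruhat_le_swap_pos[OF wx bounds(1) ij(2) bounds(2) less]
        card_edges_at_swap_pos_le[OF h wx ij less] by (simp add: y)
  qed
qed

section \<open>From a generator to the longest permutation\<close>

text \<open>Follow the values from \<open>w l\<close> up to \<open>n\<close>. The position of the
  next value is at most \<open>h\<close> of the current position, hence at most
  \<open>h i = i\<close>, so all these values sit in the first \<open>i\<close> positions.\<close>

lemma generator_block:
  assumes gen: "generator n h w" and h: "hessenberg n h"
    and i: "i \<in> {1..n}" "h i = i" and l: "l \<in> {1..i}" and j: "i < j" "j \<le> n"
  shows "w j < w l"
proof (rule ccontr)
  from gen have w: "w permutes {1..n}" by (simp add: generator_def)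
  have upward: "inv w k \<in> {1..i}" if "w l \<le> k" "k \<le> n" for k
    using that
  proof (induction k rule: dec_induct)
    case base
    show ?case using l permutes_inverses(2)[OF w] by simp
  next
    case (step k)
    then have IH: "inv w k \<in> {1..i}" by simp
    then have in_n: "inv w k \<in> {1..n}" using i by auto
    have "w (inv w k) = k" using permutes_inverses(1)[OF w] by simp
    then have "inv w (k + 1) \<le> h (inv w k)"
      using gen in_n step.prems unfolding generator_def by fastforce
    also have "\<dots> \<le> i" using hessenberg_mono[OF h in_n i(1)] IH i by simp
    finally have "inv w (Suc k) \<le> i" by simp
    moreover have "inv w (Suc k) \<in> {1..n}"
      using permutes_in_image[OF permutes_inv[OF w], of "Suc k"] step.prems by simp
    ultimately show ?case by simp
  qed
  assume "\<not> w j < w l"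
  moreover have "w j \<le> n" using permutes_in_image[OF w, of j] j by simp
  ultimately have "inv w (w j) \<in> {1..i}" by (intro upward) simp_all
  then show False using j permutes_inverses(2)[OF w] by simp
qed

lemma permutes_descending_eq_longest_perm:
  assumes u: "u permutes {1..n}" and desc: "\<And>i. 1 \<le> i \<Longrightarrow> i < n \<Longrightarrow> u (Suc i) < u i"
  shows "u = longest_perm n"
proof
  fix i
  show "u i = longest_perm n i"
  proof (cases "i \<in> {1..n}")
    case True
    have in_n: "u j \<in> {1..n}" if "j \<in> {1..n}" for j
      using permutes_in_image[OF u] that by blast
    \<comment> \<open>Each descent drops by at least one. Starting from \<open>u 1 \<le> n\<close>
      this bounds \<open>u i\<close> from above; counting back from \<open>1 \<le> u n\<close>
      bounds it from below.\<close>
    have "u (Suc k) + k \<le> n" if "Suc k \<le> n" for k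
      using that
    proof (induction k)
      case (Suc k)
      then show ?case using desc[of "Suc k"] by simp
    qed (use in_n[of 1] in auto)
    from this[of "i - 1"] have "u i + i \<le> Suc n" using True by auto
    moreover have "Suc k \<le> u (n - k)" if "k < n" for k
      using that
    proof (induction k)
      case (Suc k)
      then have "Suc (n - Suc k) = n - k" "1 \<le> n - Suc k" "n - Suc k < n" by auto
      then show ?case using Suc desc[of "n - Suc k"] by simp
    qed (use in_n[of n] in auto)
    from this[of "n - i"] have "Suc n \<le> u i + i" using True by auto
    ultimately show ?thesis using True by (simp add: longest_perm_def)
  next
    case False
    then show ?thesis using permutes_not_in[OF u False] by (auto simp: longest_perm_def)
  qed
qed

text \<open>With \<open>m\<close> the least value of \<open>w\<close> on the first \<open>i\<close>
  positions, the rank entry at \<open>(i, m)\<close> is already the maximal \<open>i\<close>, so it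
  is \<open>i\<close> for \<open>u\<close> too. Exactly \<open>i\<close> values are at least
  \<open>m\<close>, so \<open>u\<close> has them all in its first \<open>i\<close>
  positions.\<close>

lemma bruhat_le_block:
  assumes wu: "bruhat_le n w u" and i: "1 \<le> i" "i < n"
    and block: "\<And>l j. l \<in> {1..i} \<Longrightarrow> i < j \<Longrightarrow> j \<le> n \<Longrightarrow> w j < w l"
  shows "u (Suc i) < u i"
proof -
  have w: "w permutes {1..n}" and u: "u permutes {1..n}"
    using wu bruhat_le_permutes[OF wu] by (simp_all add: bruhat_le_def)
  define m where "m = Min (w ` {1..i})"
  have m_le: "m \<le> w l" if "l \<in> {1..i}" for l using that by (simp add: m_def)
  have "m \<in> w ` {1..i}" unfolding m_def using i by (intro Min_in) auto
  then obtain l where l: "l \<in> {1..i}" "w l = m" by auto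
  have "{l \<in> {1..i}. m \<le> w l} = {1..i}" using m_le by blast
  then have "rank_mat w i m = i" by (simp add: rank_mat_def)
  then have "card {l \<in> {1..i}. m \<le> u l} \<ge> card {1..i}"
    using bruhat_le_imp_rank_mat_le[OF wu, of i m] by (simp add: rank_mat_def)
  then have "{l \<in> {1..i}. m \<le> u l} = {1..i}" by (intro card_seteq) auto
  then have um: "m \<le> u l" if "l \<in> {1..i}" for l using that by blast
  have "rank_mat w n m = i"
  proof -
    have "{k \<in> {1..n}. m \<le> w k} = {1..i}"
      using m_le block[OF l(1)] l i by (auto simp: not_le[symmetric]) (metis not_le)
    then show ?thesis by (simp add: rank_mat_def)
  qed
  \<comment> \<open>The full prefix sees every value once, so this count is the same for
    \<open>u\<close> and \<open>w\<close>.\<close>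
  moreover have "rank_mat x n m = card {m..n}" if "x permutes {1..n}" "1 \<le> m" for x
  proof -
    have "x ` {k \<in> {1..n}. m \<le> x k} = x ` {1..n} \<inter> {m..}" by blast
    also have "\<dots> = {m..n}" using permutes_image[OF that(1)] that(2) by auto
    finally have "x ` {k \<in> {1..n}. m \<le> x k} = {m..n}" .
    then show ?thesis
      unfolding rank_mat_def
      using card_image[of x "{k \<in> {1..n}. m \<le> x k}"] permutes_inj_on[OF that(1)] by metis
  qed
  moreover have "1 \<le> m" using permutes_in_image[OF w, of l] l i by auto
  ultimately have "card {k \<in> {1..n}. m \<le> u k} = i"
    using u w by (metis rank_mat_def)
  moreover have "{1..i} \<subseteq> {k \<in> {1..n}. m \<le> u k}" using um i by auto
  ultimately have "{1..i} = {k \<in> {1..n}. m \<le> u k}" by (intro card_subset_eq) auto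
  then have "u (Suc i) < m" using i by (metis (no_types, lifting) Suc_leI Suc_n_not_le_n
    atLeastAtMost_iff le_SucI linorder_not_less mem_Collect_eq)
  also have "m \<le> u i" using um[of i] i by simp
  finally show ?thesis .
qed

text \<open>Climb by adjacent ascents, staying above \<open>w\<close>. An ascent at \<open>i\<close>
  is an \<open>h\<close>-step unless \<open>h i = i\<close>, and there the block structure forces a
  descent. The claim covers every \<open>u\<close> above \<open>w\<close> so that the induction can
  move on from \<open>w\<close>.\<close>

lemma hbruhat_le_longest_perm:
  assumes h: "hessenberg n h" and gen: "generator n h w" and "bruhat_le n w u"
  shows "hbruhat_le n h u (longest_perm n)"
  using \<open>bruhat_le n w u\<close>
proof (induction "n * n - inv_count n u" arbitrary: u rule: less_induct)
  case (less u)
  have u: "u permutes {1..n}" by (rule bruhat_le_permutes[OF less.prems])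
  show ?case
  proof (cases "u = longest_perm n")
    case True
    then show ?thesis using u by (simp add: hbruhat_le_def)
  next
    case False
    then obtain i where i: "1 \<le> i" "i < n" and "\<not> u (Suc i) < u i"
      using permutes_descending_eq_longest_perm[OF u] by blast
    moreover have "u i \<noteq> u (Suc i)" using inj_eq[OF permutes_inj[OF u]] by simp
    ultimately have asc: "u i < u (Suc i)" by simp
    have i_in: "i \<in> {1..n}" using i by simp
    have "h i \<noteq> i"
      using bruhat_le_block[OF less.prems i] generator_block[OF gen h i_in] asc by (meson less_asym)
    then have hi: "Suc i \<le> h i" using hessenberg_bounds(1)[OF h i_in] by simp
    let ?v = "swap_pos u i (Suc i)"
    have inv: "inv_count n u < inv_count n ?v"
      using i asc by (intro inv_count_swap_pos_less) auto
    then have "n * n - inv_count n ?v < n * n - inv_count n u"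
      using inv_count_le[of n ?v] by linarith
    moreover have "bruhat_le n w ?v"
      using i asc by (intro bruhat_le_swap_pos[OF less.prems]) auto
    ultimately have "hbruhat_le n h ?v (longest_perm n)" by (rule less.hyps)
    moreover have "hbruhat_step n h u ?v"
      using u i_in hi inv unfolding hbruhat_step_def by blast
    ultimately show ?thesis
      using u by (auto simp: hbruhat_le_def intro: converse_rtranclp_into_rtranclp)
  qed
qed

theorem theorem3p8:
  fixes n :: nat and h w :: "nat \<Rightarrow> nat"
  assumes "hessenberg n h"
    and "generator n h w"
  shows "(\<forall>u \<in> bruhat_interval n w (longest_perm n). \<forall>v \<in> bruhat_interval n w (longest_perm n).
            hbruhat_le n h u v \<longrightarrow> card (edges_at n h w u) \<le> card (edges_at n h w v)) \<and>
         card (edges_at n h w w) \<le> card (edges_at n h w (longest_perm n))"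
proof (intro conjI ballI impI)
  show "card (edges_at n h w u) \<le> card (edges_at n h w v)"
    if "u \<in> bruhat_interval n w (longest_perm n)" "hbruhat_le n h u v" for u v
    using hbruhat_le_edges_at[OF assms(1)] that by (auto simp: bruhat_interval_def)
  have ww: "bruhat_le n w w"
    using assms(2) by (simp add: generator_def bruhat_le_refl)
  show "card (edges_at n h w w) \<le> card (edges_at n h w (longest_perm n))"
    using hbruhat_le_edges_at[OF assms(1) ww hbruhat_le_longest_perm[OF assms ww]] by blast
qed

end
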